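(* Let $\mathfrak{F}=(W,R,\succcurlyeq,\Cup)$ be a finite classical general intuitionistic team Kripke frame (i.e. $W$ is finite and $R$ is the identity relation on $W$) that is not distributive. Then none of the following schemes is valid on $\mathfrak{F}$ (i.e. each has an instance that is not valid on $\mathfrak{F}$): - Axiom (2): $(\phi\to\alpha)\to((\psi\to\alpha)\to(\phi\vee\psi\to\alpha))$, with $\alpha$ standard and $\phi,\psi$ arbitrary; - Axiom (3): $(\phi\to\chi)\to(\phi\vee\psi\to\chi\vee\psi)$, with $\phi,\psi,\chi$ arbitrary; - the idempotent law $\alpha\vee\alpha\to\alpha$, with $\alpha$ standard. Moreover, standard formulas are not closed under joins over $\mathfrak{F}$: there exist a standard formula $\alpha$, a model $\mathfrak{M}$ on $\mathfrak{F}$ and teams $t,s\subseteq W$ with $\mathfrak{M},t\models\alpha$ and $\mathfrak{M},s\models\alpha$ but $\mathfrak{M},t\Cup s\not\models\alpha$.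
   Context: **Language.** Fix an infinite set $\mathsf{Prop}$ of propositional variables. Formulas of the team language are $\phi::=p\mid\bot\mid\phi\wedge\phi\mid\phi\vee\phi\mid\phi\veebar\phi\mid\phi\to\phi$; $\vee$ is the local and $\veebar$ the global disjunction. Formulas without $\veebar$ are standard. **Frames.** For a nonempty set $W$ with a partial order $R$, teams are sets $t\subseteq W$; $R[t]=\{v\mid\exists w\in t:\ wRv\}$; and $tR^\circ s$ iff $\forall w\in t\,\exists v\in s\,(wRv)$ and $\forall v\in s\,\exists w\in t\,(wRv)$. A general intuitionistic team Kripke frame is $(W,R,\succcurlyeq,\Cup)$ where $W\neq\varnothing$, $R$ is a partial order on $W$, $\Cup$ is a binary operation on $\wp(W)$ such that $(\wp(W),\Cup,\varnothing)$ is a bounded join-semilattice ($\Cup$ associative, commutative, idempotent, $\varnothing\Cup t=t$), $\preccurlyeq$ is the induced partial order ($t\preccurlyeq s$ iff $t\Cup s=s$) with converse $\succcurlyeq$, and for all $t,s,s'\subseteq W$: - (a) if $tR^\circ s$ and $s\succcurlyeq s'$, then there is $t'\subseteq W$ with $t\succcurlyeq t'$ and $t'R^\circ s'$; - (b) $t\succcurlyeq\circ R^\circ s$ implies $R[t]\succcurlyeq s$, where $t\succcurlyeq\circ R^\circ s$ means there is $r\subseteq W$ with $t\succcurlyeq r$ and $rR^\circ s$; - (c) $R[t]\Cup R[s]=R[t\Cup s]$. The frame is distributive if for all $t,r,s\subseteq W$, $t\preccurlyeq r\Cup s$ implies that there are $r',s'\subseteq W$ with $r'\preccurlyeq r$,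 $s'\preccurlyeq s$ and $t=r'\Cup s'$. A model on the frame adds a valuation $V:\mathsf{Prop}\to\wp(W)$ persistent w.r.t. $R$ ($w\in V(p)$, $wRv$ imply $v\in V(p)$). **Generalized team semantics:** - $\mathfrak{M},t\models p$ iff $t\preccurlyeq V(p)$; - $\mathfrak{M},t\models\bot$ iff $t=\varnothing$; - $\mathfrak{M},t\models\phi\wedge\psi$ iff $\mathfrak{M},t\models\phi$ and $\mathfrak{M},t\models\psi$; - $\mathfrak{M},t\models\phi\vee\psi$ iff there are $s,r\subseteq W$ with $t\preccurlyeq s\Cup r$, $\mathfrak{M},s\models\phi$ and $\mathfrak{M},r\models\psi$; - $\mathfrak{M},t\models\phi\veebar\psi$ iff $\mathfrak{M},t\models\phi$ or $\mathfrak{M},t\models\psi$; - $\mathfrak{M},t\models\phi\to\psi$ iff for all $s\subseteq W$ with $t\succcurlyeq\circ R^\circ s$, $\mathfrak{M},s\models\phi$ implies $\mathfrak{M},s\models\psi$. A formula is valid on a frame if it holds at all teams in all models on the frame. *)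

theory Defs
  imports Main
begin

datatype 'p form =
    Var 'p
  | Falsum
  | Conj "'p form" "'p form"
  | LDisj "'p form" "'p form" \<comment> \<open>local disjunction\<close>
  | GDisj "'p form" "'p form" \<comment> \<open>global disjunction\<close>
  | Impl "'p form" "'p form"

primrec standard :: "'p form \<Rightarrow> bool" where
  "standard (Var p) \<longleftrightarrow> True"
| "standard Falsum \<longleftrightarrow> True"
| "standard (Conj \<phi> \<psi>) \<longleftrightarrow> standard \<phi> \<and> standard \<psi>"
| "standard (LDisj \<phi> \<psi>) \<longleftrightarrow> standard \<phi> \<and> standard \<psi>"
| "standard (GDisj \<phi> \<psi>) \<longleftrightarrow> False"
| "standard (Impl \<phi> \<psi>) \<longleftrightarrow> standard \<phi> \<and> standard \<psi>"

text \<open>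
  The order on teams is not a separate component of a frame, as it is determined by the join.
  Only the values of \<open>tjoin\<close> on subsets of \<open>worlds\<close> matter.
\<close>

record 'w frame =
  worlds :: "'w set"
  acc :: "('w \<times> 'w) set"
  tjoin :: "'w set \<Rightarrow> 'w set \<Rightarrow> 'w set"

definition team_le :: "'w frame \<Rightarrow> 'w set \<Rightarrow> 'w set \<Rightarrow> bool" where
  "team_le F t s \<longleftrightarrow> tjoin F t s = s"

text \<open>The relation \<open>R\<^sup>\<circ>\<close>.\<close>

definition lift_acc :: "'w frame \<Rightarrow> 'w set \<Rightarrow> 'w set \<Rightarrow> bool" where
  "lift_acc F t s \<longleftrightarrow>
     (\<forall>w\<in>t. \<exists>v\<in>s. (w, v) \<in> acc F) \<and> (\<forall>v\<in>s. \<exists>w\<in>t. (w, v) \<in> acc F)"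

text \<open>The composition of \<open>\<succcurlyeq>\<close> and \<open>R\<^sup>\<circ>\<close>.\<close>

definition team_acc :: "'w frame \<Rightarrow> 'w set \<Rightarrow> 'w set \<Rightarrow> bool" where
  "team_acc F t s \<longleftrightarrow> (\<exists>r\<subseteq>worlds F. team_le F r t \<and> lift_acc F r s)"

definition bounded_join_semilattice_on_teams :: "'w frame \<Rightarrow> bool" where
  "bounded_join_semilattice_on_teams F \<longleftrightarrow>
     (\<forall>t\<subseteq>worlds F. \<forall>s\<subseteq>worlds F. tjoin F t s \<subseteq> worlds F) \<and>
     (\<forall>t\<subseteq>worlds F. \<forall>s\<subseteq>worlds F. \<forall>r\<subseteq>worlds F.
        tjoin F (tjoin F t s) r = tjoin F t (tjoin F s r)) \<and>
     (\<forall>t\<subseteq>worlds F. \<forall>s\<subseteq>worlds F. tjoin F t s = tjoin F s t) \<and>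
     (\<forall>t\<subseteq>worlds F. tjoin F t t = t) \<and>
     (\<forall>t\<subseteq>worlds F. tjoin F {} t = t)"

definition general_team_frame :: "'w frame \<Rightarrow> bool" where
  "general_team_frame F \<longleftrightarrow>
     worlds F \<noteq> {} \<and>
     partial_order_on (worlds F) (acc F) \<and>
     bounded_join_semilattice_on_teams F \<and>
     (\<forall>t\<subseteq>worlds F. \<forall>s\<subseteq>worlds F. \<forall>s'\<subseteq>worlds F.
        lift_acc F t s \<and> team_le F s' s \<longrightarrow>
        (\<exists>t'\<subseteq>worlds F. team_le F t' t \<and> lift_acc F t' s')) \<and>
     (\<forall>t\<subseteq>worlds F. \<forall>s\<subseteq>worlds F. team_acc F t s \<longrightarrow> team_le F s (acc F `` t)) \<and>
     (\<forall>t\<subseteq>worlds F. \<forall>s\<subseteq>worlds F.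
        tjoin F (acc F `` t) (acc F `` s) = acc F `` tjoin F t s)"

definition distributive_frame :: "'w frame \<Rightarrow> bool" where
  "distributive_frame F \<longleftrightarrow>
     (\<forall>t\<subseteq>worlds F. \<forall>r\<subseteq>worlds F. \<forall>s\<subseteq>worlds F.
        team_le F t (tjoin F r s) \<longrightarrow>
        (\<exists>r'\<subseteq>worlds F. \<exists>s'\<subseteq>worlds F.
           team_le F r' r \<and> team_le F s' s \<and> t = tjoin F r' s'))"

definition classical_frame :: "'w frame \<Rightarrow> bool" where
  "classical_frame F \<longleftrightarrow> acc F = Id_on (worlds F)"

definition valuation_on :: "'w frame \<Rightarrow> ('p \<Rightarrow> 'w set) \<Rightarrow> bool" where
  "valuation_on F V \<longleftrightarrow>
     (\<forall>p. V p \<subseteq> worlds F) \<and> (\<forall>p w v. w \<in> V p \<and> (w, v) \<in> acc F \<longrightarrow> v \<in> V p)"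

primrec sat :: "'w frame \<Rightarrow> ('p \<Rightarrow> 'w set) \<Rightarrow> 'w set \<Rightarrow> 'p form \<Rightarrow> bool" where
  "sat F V t (Var p) \<longleftrightarrow> team_le F t (V p)"
| "sat F V t Falsum \<longleftrightarrow> t = {}"
| "sat F V t (Conj \<phi> \<psi>) \<longleftrightarrow> sat F V t \<phi> \<and> sat F V t \<psi>"
| "sat F V t (LDisj \<phi> \<psi>) \<longleftrightarrow>
     (\<exists>s\<subseteq>worlds F. \<exists>r\<subseteq>worlds F. team_le F t (tjoin F s r) \<and> sat F V s \<phi> \<and> sat F V r \<psi>)"
| "sat F V t (GDisj \<phi> \<psi>) \<longleftrightarrow> sat F V t \<phi> \<or> sat F V t \<psi>"
| "sat F V t (Impl \<phi> \<psi>) \<longleftrightarrow>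
     (\<forall>s\<subseteq>worlds F. team_acc F t s \<longrightarrow> sat F V s \<phi> \<longrightarrow> sat F V s \<psi>)"

definition valid_on :: "'w frame \<Rightarrow> 'p form \<Rightarrow> bool" where
  "valid_on F \<phi> \<longleftrightarrow> (\<forall>V. valuation_on F V \<longrightarrow> (\<forall>t\<subseteq>worlds F. sat F V t \<phi>))"

text \<open>A scheme is the set of its instances.\<close>

definition scheme_valid_on :: "'w frame \<Rightarrow> 'p form set \<Rightarrow> bool" where
  "scheme_valid_on F S \<longleftrightarrow> (\<forall>\<phi>\<in>S. valid_on F \<phi>)"

definition disj_elim_scheme :: "'p form set" where
  "disj_elim_scheme =
     {Impl (Impl \<phi> \<alpha>) (Impl (Impl \<psi> \<alpha>) (Impl (LDisj \<phi> \<psi>) \<alpha>)) |\<phi> \<psi> \<alpha>. standard \<alpha>}"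

definition disj_mono_scheme :: "'p form set" where
  "disj_mono_scheme =
     {Impl (Impl \<phi> \<chi>) (Impl (LDisj \<phi> \<psi>) (LDisj \<chi> \<psi>)) |\<phi> \<psi> \<chi>. True}"

definition disj_idem_scheme :: "'p form set" where
  "disj_idem_scheme = {Impl (LDisj \<alpha> \<alpha>) \<alpha> |\<alpha>. standard \<alpha>}"

end

(*
  On a classical frame the lifted relation is equality, so an implication quantifies over the
  teams below t in the join-semilattice. If distributivity fails at t below the join of r and s,
  let b be the largest join of a team below r and t with a team below s and t. With p and q naming
  t and b, the teams r and s satisfy p -> q, but their join does not. This refutes closure under
  joins, hence the idempotent law and Axiom (2) with all formulas equal to p -> q.
  Axiom (3) would allow r and then s to be replaced by b in the cover of t by r and s, yielding
  that t is below b.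
*)

theory Submission
  imports Defs
begin

locale classical_team_frame =
  fixes F :: "'w frame"
  assumes general: "general_team_frame F"
    and classical: "classical_frame F"
begin

section \<open>Order theory of the join-semilattice of teams\<close>

lemma join_closed: "t \<subseteq> worlds F \<Longrightarrow> s \<subseteq> worlds F \<Longrightarrow> tjoin F t s \<subseteq> worlds F"
  and join_assoc: "t \<subseteq> worlds F \<Longrightarrow> s \<subseteq> worlds F \<Longrightarrow> r \<subseteq> worlds F \<Longrightarrow>
    tjoin F (tjoin F t s) r = tjoin F t (tjoin F s r)"
  and join_commute: "t \<subseteq> worlds F \<Longrightarrow> s \<subseteq> worlds F \<Longrightarrow> tjoin F t s = tjoin F s t"
  and join_idem: "t \<subseteq> worlds F \<Longrightarrow> tjoin F t t = t"
  and join_empty: "t \<subseteq> worlds F \<Longrightarrow> tjoin F {} t = t"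
proof -
  have "bounded_join_semilattice_on_teams F"
    using general by (simp add: general_team_frame_def)
  note semilattice = this[unfolded bounded_join_semilattice_on_teams_def]
  show "t \<subseteq> worlds F \<Longrightarrow> s \<subseteq> worlds F \<Longrightarrow> tjoin F t s \<subseteq> worlds F"
    using semilattice[THEN conjunct1] by simp
  show "t \<subseteq> worlds F \<Longrightarrow> s \<subseteq> worlds F \<Longrightarrow> r \<subseteq> worlds F \<Longrightarrow>
    tjoin F (tjoin F t s) r = tjoin F t (tjoin F s r)"
    using semilattice[THEN conjunct2, THEN conjunct1] by simp
  show "t \<subseteq> worlds F \<Longrightarrow> s \<subseteq> worlds F \<Longrightarrow> tjoin F t s = tjoin F s t"
    using semilattice[THEN conjunct2, THEN conjunct2, THEN conjunct1] by simp
  show "t \<subseteq> worlds F \<Longrightarrow> tjoin F t t = t" "t \<subseteq> worlds F \<Longrightarrow> tjoin F {} t = t"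
    using semilattice by simp_all
qed

lemma le_refl: "t \<subseteq> worlds F \<Longrightarrow> team_le F t t"
  by (simp add: team_le_def join_idem)

lemma empty_le: "t \<subseteq> worlds F \<Longrightarrow> team_le F {} t"
  by (simp add: team_le_def join_empty)

lemma le_trans:
  assumes "t \<subseteq> worlds F" "s \<subseteq> worlds F" "r \<subseteq> worlds F" "team_le F t s" "team_le F s r"
  shows "team_le F t r"
  using assms join_assoc[of t s r] by (simp add: team_le_def)

lemma le_antisym:
  assumes "t \<subseteq> worlds F" "s \<subseteq> worlds F" "team_le F t s" "team_le F s t"
  shows "t = s"
  using assms join_commute[of t s] by (simp add: team_le_def)

lemma join_upper1:
  assumes "t \<subseteq> worlds F" "s \<subseteq> worlds F"
  shows "team_le F t (tjoin F t s)"
  using assms join_assoc[of t t s] by (simp add: team_le_def join_idem)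

lemma join_upper2:
  assumes "t \<subseteq> worlds F" "s \<subseteq> worlds F"
  shows "team_le F s (tjoin F t s)"
  using assms join_upper1[of s t] by (simp add: join_commute)

lemma join_least:
  assumes "t \<subseteq> worlds F" "s \<subseteq> worlds F" "r \<subseteq> worlds F" "team_le F t r" "team_le F s r"
  shows "team_le F (tjoin F t s) r"
  using assms join_assoc[of t s r] by (simp add: team_le_def)

lemma join_mono:
  assumes "t \<subseteq> worlds F" "s \<subseteq> worlds F" "t' \<subseteq> worlds F" "s' \<subseteq> worlds F"
    and "team_le F t t'" "team_le F s s'"
  shows "team_le F (tjoin F t s) (tjoin F t' s')"
  using assms
  by (meson join_least join_closed join_upper1 join_upper2 le_trans)

section \<open>Semantics over the identity relation\<close>

lemma team_acc_iff:
  assumes "t \<subseteq> worlds F" "s \<subseteq> worlds F"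
  shows "team_acc F t s \<longleftrightarrow> team_le F s t"
proof -
  \<comment> \<open>The two halves of \<open>lift_acc\<close> give the two inclusions. The converse
    needs \<open>r\<close> inside \<open>worlds F\<close>, since \<open>acc F\<close> is reflexive
    only there.\<close>
  have "lift_acc F r s \<longleftrightarrow> r = s" if "r \<subseteq> worlds F" for r
  proof -
    have "(w, v) \<in> acc F \<longleftrightarrow> w = v \<and> w \<in> worlds F" for w v
      using classical by (auto simp: classical_frame_def)
    then show ?thesis
      using that assms(2) unfolding lift_acc_def by auto
  qed
  then show ?thesis
    using assms unfolding team_acc_def by blast
qed

lemma sat_Impl_iff:
  assumes "t \<subseteq> worlds F"
  shows "sat F V t (Impl \<phi> \<psi>) \<longleftrightarrow>
    (\<forall>s\<subseteq>worlds F. team_le F s t \<longrightarrow> sat F V s \<phi> \<longrightarrow> sat F V s \<psi>)"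
  using assms by (auto simp: team_acc_iff)

lemma sat_ImplD:
  assumes "t \<subseteq> worlds F" "sat F V t (Impl \<phi> \<psi>)" "sat F V t \<phi>"
  shows "sat F V t \<psi>"
  using assms by (simp add: team_acc_iff le_refl)

lemma valid_on_ImplD:
  assumes "valid_on F (Impl \<phi> \<psi>)" "valuation_on F V" "t \<subseteq> worlds F" "sat F V t \<phi>"
  shows "sat F V t \<psi>"
  using assms sat_ImplD unfolding valid_on_def by blast

text \<open>Persistence is trivial along the identity, so countermodels may send variables to
  arbitrary teams.\<close>

lemma valuation_on_iff: "valuation_on F V \<longleftrightarrow> (\<forall>p. V p \<subseteq> worlds F)"
  using classical by (auto simp: valuation_on_def classical_frame_def)

section \<open>Greatest elements and failures of distributivity\<close>

lemma finite_join_closed_has_greatest: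
  assumes "finite J" "J \<noteq> {}" "J \<subseteq> Pow (worlds F)"
    and closed: "\<And>x y. x \<in> J \<Longrightarrow> y \<in> J \<Longrightarrow> tjoin F x y \<in> J"
  obtains b where "b \<in> J" "\<And>x. x \<in> J \<Longrightarrow> team_le F x b"
proof -
  \<comment> \<open>The bound is sought in \<open>J\<close> and not in \<open>A\<close>: subsets of
    \<open>J\<close> need not be closed under joins, and the empty one has no member to
    offer.\<close>
  have "\<exists>b\<in>J. \<forall>x\<in>A. team_le F x b" if "finite A" "A \<subseteq> J" for A
    using that
  proof (induction A rule: finite_induct)
    case empty
    then show ?case using \<open>J \<noteq> {}\<close> by blast
  next
    case (insert a A)
    then obtain b where b: "b \<in> J" "\<forall>x\<in>A. team_le F x b" by auto
    have W: "a \<subseteq> worlds F" "b \<subseteq> worlds F" "\<And>x. x \<in> A \<Longrightarrow> x \<subseteq> worlds F"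
      using insert.prems b(1) assms(3) by auto
    have "team_le F x (tjoin F a b)" if "x \<in> insert a A" for x
    proof (cases "x = a")
      case True
      then show ?thesis using W(1,2) by (simp add: join_upper1)
    next
      case False
      then have x: "x \<in> A" using that by simp
      show ?thesis
        using le_trans[OF W(3)[OF x] W(2) join_closed[OF W(1,2)]] x b(2) join_upper2[OF W(1,2)]
        by blast
    qed
    moreover have "tjoin F a b \<in> J"
      using closed b(1) insert.prems by simp
    ultimately show ?case by blast
  qed
  then obtain b where "b \<in> J" "\<forall>x\<in>J. team_le F x b" using assms(1) by blast
  then show thesis using that by simp
qed

text \<open>Here b is the join of the meets of t with r and with s.\<close>

lemma non_distributive_witness:
  assumes "finite (worlds F)" "\<not> distributive_frame F"
  obtains t r s b where
    "t \<subseteq> worlds F" "r \<subseteq> worlds F" "s \<subseteq> worlds F" "b \<subseteq> worlds F"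
    "team_le F t (tjoin F r s)" "\<not> team_le F t b"
    "\<And>u. u \<subseteq> worlds F \<Longrightarrow> team_le F u r \<Longrightarrow> team_le F u t \<Longrightarrow> team_le F u b"
    "\<And>u. u \<subseteq> worlds F \<Longrightarrow> team_le F u s \<Longrightarrow> team_le F u t \<Longrightarrow> team_le F u b"
proof -
  from assms(2) have "\<exists>t\<subseteq>worlds F. \<exists>r\<subseteq>worlds F. \<exists>s\<subseteq>worlds F. team_le F t (tjoin F r s) \<and>
      \<not> (\<exists>r'\<subseteq>worlds F. \<exists>s'\<subseteq>worlds F. team_le F r' r \<and> team_le F s' s \<and> t = tjoin F r' s')"
    unfolding distributive_frame_def by simp
  then obtain t r s where
    W: "t \<subseteq> worlds F" "r \<subseteq> worlds F" "s \<subseteq> worlds F"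
    and le: "team_le F t (tjoin F r s)"
    and nd: "\<And>r' s'. r' \<subseteq> worlds F \<Longrightarrow> s' \<subseteq> worlds F \<Longrightarrow> team_le F r' r \<Longrightarrow> team_le F s' s \<Longrightarrow>
      t \<noteq> tjoin F r' s'"
    by (elim exE conjE) blast
  \<comment> \<open>\<open>D x\<close> holds the common lower bounds of \<open>x\<close> and
    \<open>t\<close>. The greatest element of the joins in \<open>J\<close> below yields
    \<open>b\<close> directly, without a separate construction of meets.\<close>
  define D where "D x = {u. u \<subseteq> worlds F \<and> team_le F u x \<and> team_le F u t}" for x
  have D_join: "tjoin F u v \<in> D x" if "u \<in> D x" "v \<in> D x" "x \<subseteq> worlds F" for u v x
    using that W by (simp add: D_def join_least join_closed)
  define J where "J = {tjoin F u v |u v. u \<in> D r \<and> v \<in> D s}"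
  have J_sub: "J \<subseteq> Pow (worlds F)"
    unfolding J_def D_def using join_closed by blast
  have empty_D: "{} \<in> D x" if "x \<subseteq> worlds F" for x
    using that W by (simp add: D_def empty_le)
  have Dr: "D r \<subseteq> J"
  \<comment> \<open>Joining with the empty team, which lies in every \<open>D x\<close>, exhibits a
    member of one factor as a member of \<open>J\<close>.\<close>
  proof
    fix u assume "u \<in> D r"
    moreover from this have "u = tjoin F u {}"
      by (simp add: D_def join_commute[of u] join_empty)
    ultimately show "u \<in> J" using empty_D W unfolding J_def by blast
  qed
  have Ds: "D s \<subseteq> J"
  proof
    fix u assume "u \<in> D s"
    moreover from this have "u = tjoin F {} u"
      by (simp add: D_def join_empty)
    ultimately show "u \<in> J" using empty_D W unfolding J_def by blast
  qed
  have J_join: "tjoin F x y \<in> J" if xy: "x \<in> J" "y \<in> J" for x y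
  proof -
    from xy obtain u v u' v' where
      x: "x = tjoin F u v" "u \<in> D r" "v \<in> D s" and y: "y = tjoin F u' v'" "u' \<in> D r" "v' \<in> D s"
      unfolding J_def by blast
    then have Wu: "u \<subseteq> worlds F" "v \<subseteq> worlds F" "u' \<subseteq> worlds F" "v' \<subseteq> worlds F"
      by (auto simp: D_def)
    \<comment> \<open>Regrouping collects the parts below \<open>r\<close> and the parts below
      \<open>s\<close>, so that \<open>D_join\<close> applies to each.\<close>
    have "tjoin F x y = tjoin F (tjoin F u u') (tjoin F v v')"
      unfolding x y using Wu by (smt (verit) join_assoc join_closed join_commute)
    then show ?thesis using x y D_join W unfolding J_def by blast
  qed
  have "finite J" using J_sub assms(1) by (meson finite_Pow_iff finite_subset)
  moreover have "J \<noteq> {}" using Dr empty_D W by blast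
  ultimately obtain b where b: "b \<in> J" "\<And>x. x \<in> J \<Longrightarrow> team_le F x b"
    using J_sub J_join finite_join_closed_has_greatest by metis
  from b(1) obtain u v where uv: "b = tjoin F u v" "u \<in> D r" "v \<in> D s"
    unfolding J_def by blast
  have Wb: "b \<subseteq> worlds F" using b(1) J_sub by blast
  have "team_le F b t"
    using uv W by (auto simp: D_def intro: join_least)
  \<comment> \<open>As a member of \<open>J\<close>, \<open>b\<close> is a join of a team below
    \<open>r\<close> and a team below \<open>s\<close>, which is the form that \<open>t\<close>
    cannot have.\<close>
  moreover have "t \<noteq> b" using uv nd by (auto simp: D_def)
  ultimately have "\<not> team_le F t b" using le_antisym W Wb by blast
  moreover have "team_le F u b"
    if "u \<subseteq> worlds F" "team_le F u r \<or> team_le F u s" "team_le F u t" for u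
    using that b(2) Dr Ds by (auto simp: D_def)
  ultimately show thesis
    using that[OF W Wb le] by simp
qed

section \<open>Closure under joins, the idempotent law and Axiom (2)\<close>

lemma not_closed_under_joins:
  fixes p q :: 'p
  assumes "finite (worlds F)" "\<not> distributive_frame F" "p \<noteq> q"
  obtains V t s where
    "valuation_on F V" "t \<subseteq> worlds F" "s \<subseteq> worlds F"
    "sat F V t (Impl (Var p) (Var q))" "sat F V s (Impl (Var p) (Var q))"
    "\<not> sat F V (tjoin F t s) (Impl (Var p) (Var q))"
proof -
  obtain t r s b where
    W: "t \<subseteq> worlds F" "r \<subseteq> worlds F" "s \<subseteq> worlds F" "b \<subseteq> worlds F"
    and wit: "team_le F t (tjoin F r s)" "\<not> team_le F t b"
    "\<And>u. u \<subseteq> worlds F \<Longrightarrow> team_le F u r \<Longrightarrow> team_le F u t \<Longrightarrow> team_le F u b"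
    "\<And>u. u \<subseteq> worlds F \<Longrightarrow> team_le F u s \<Longrightarrow> team_le F u t \<Longrightarrow> team_le F u b"
    using non_distributive_witness[OF assms(1,2)] by metis
  define V where "V x = (if x = p then t else b)" for x
  have V: "V p = t" "V q = b" "valuation_on F V"
    using W assms(3) by (auto simp: V_def valuation_on_iff)
  \<comment> \<open>A team below \<open>r\<close> that satisfies \<open>p\<close> is below both
    \<open>r\<close> and \<open>t\<close>, hence below \<open>b\<close>; likewise for
    \<open>s\<close>.\<close>
  have "sat F V r (Impl (Var p) (Var q))" "sat F V s (Impl (Var p) (Var q))"
    using W wit(3,4) V(1,2) by (auto simp: sat_Impl_iff simp del: sat.simps(6))
  \<comment> \<open>The team \<open>t\<close> is itself the counterexample: it lies below the join
    and satisfies \<open>p\<close> but not \<open>q\<close>.\<close>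
  moreover have "\<not> sat F V (tjoin F r s) (Impl (Var p) (Var q))"
    using W wit(1,2) V(1,2) le_refl[of t] join_closed[of r s]
    by (auto simp: sat_Impl_iff simp del: sat.simps(6))
  ultimately show thesis using that W V(3) by blast
qed

lemma sat_LDisj_join:
  assumes "t \<subseteq> worlds F" "s \<subseteq> worlds F" "sat F V t \<phi>" "sat F V s \<psi>"
  shows "sat F V (tjoin F t s) (LDisj \<phi> \<psi>)"
  using assms join_closed[of t s] le_refl[of "tjoin F t s"] by auto

text \<open>The join satisfies \<alpha> \<or> \<alpha> with \<open>t\<close> and \<open>s\<close> as
  witnesses, and the idempotent law then removes the disjunction.\<close>

lemma disj_idem_imp_join_closed:
  assumes "scheme_valid_on F (disj_idem_scheme :: 'p form set)" "standard (\<alpha> :: 'p form)" "valuation_on F V"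
    and "t \<subseteq> worlds F" "s \<subseteq> worlds F" "sat F V t \<alpha>" "sat F V s \<alpha>"
  shows "sat F V (tjoin F t s) \<alpha>"
proof -
  have "valid_on F (Impl (LDisj \<alpha> \<alpha>) \<alpha>)"
    using assms(1,2) unfolding scheme_valid_on_def disj_idem_scheme_def by blast
  then show ?thesis
    using assms(3-) by (simp add: valid_on_ImplD sat_LDisj_join join_closed del: sat.simps)
qed

text \<open>With \<alpha> for all three formulas, both premises of Axiom (2) become the valid
  \<alpha> \<rightarrow> \<alpha> and can be discharged.\<close>

lemma disj_elim_imp_disj_idem:
  assumes "scheme_valid_on F (disj_elim_scheme :: 'p form set)"
  shows "scheme_valid_on F (disj_idem_scheme :: 'p form set)"
proof -
  have "valid_on F (Impl (LDisj \<alpha> \<alpha>) \<alpha>)" if "standard \<alpha>" for \<alpha> :: "'p form"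
  proof -
    have "valid_on F (Impl (Impl \<alpha> \<alpha>) (Impl (Impl \<alpha> \<alpha>) (Impl (LDisj \<alpha> \<alpha>) \<alpha>)))"
      using assms that unfolding scheme_valid_on_def disj_elim_scheme_def by blast
    moreover have "valid_on F (Impl \<alpha> \<alpha>)"
      by (simp add: valid_on_def)
    ultimately have "sat F V t (Impl (LDisj \<alpha> \<alpha>) \<alpha>)"
      if "valuation_on F V" "t \<subseteq> worlds F" for V t
      using that by (metis valid_on_ImplD valid_on_def)
    then show ?thesis
      unfolding valid_on_def by blast
  qed
  then show ?thesis unfolding scheme_valid_on_def disj_idem_scheme_def by blast
qed

section \<open>Axiom (3)\<close>

lemma sat_LDisj_Var_iff:
  assumes "valuation_on F V" "t \<subseteq> worlds F"
  shows "sat F V t (LDisj (Var p) (Var q)) \<longleftrightarrow> team_le F t (tjoin F (V p) (V q))"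
proof
  assume "sat F V t (LDisj (Var p) (Var q))"
  then obtain s r where sr: "s \<subseteq> worlds F" "r \<subseteq> worlds F" "team_le F t (tjoin F s r)"
    "team_le F s (V p)" "team_le F r (V q)"
    by auto
  moreover have "V p \<subseteq> worlds F" "V q \<subseteq> worlds F"
    using assms(1) by (auto simp: valuation_on_iff)
  \<comment> \<open>Monotonicity of the join lets the witnesses grow to the largest teams satisfying
    the variables.\<close>
  ultimately show "team_le F t (tjoin F (V p) (V q))"
    using le_trans[OF assms(2) _ _ sr(3)] join_mono[OF sr(1,2)] by (simp add: join_closed)
next
  assume "team_le F t (tjoin F (V p) (V q))"
  moreover have "V p \<subseteq> worlds F" "V q \<subseteq> worlds F"
    using assms(1) by (auto simp: valuation_on_iff)
  ultimately show "sat F V t (LDisj (Var p) (Var q))"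
    using le_refl by (metis sat.simps(1,4))
qed

text \<open>One replacement step in a cover of \<open>t\<close>. The premise \<open>imp\<close> only
  concerns teams below \<open>t\<close>, because it expresses that \<open>t\<close> satisfies an
  implication.\<close>

lemma disj_mono_Var:
  assumes "scheme_valid_on F (disj_mono_scheme :: 'p form set)"
    and V: "valuation_on F V" and t: "t \<subseteq> worlds F"
    and imp: "\<And>u. u \<subseteq> worlds F \<Longrightarrow> team_le F u (V p) \<Longrightarrow> team_le F u t \<Longrightarrow> team_le F u (V p')"
    and le: "team_le F t (tjoin F (V p) (V q))"
  shows "team_le F t (tjoin F (V p') (V (q :: 'p)))"
proof -
  have "valid_on F (Impl (Impl (Var p) (Var p'))
      (Impl (LDisj (Var p) (Var q)) (LDisj (Var p') (Var q))))"
    using assms(1) unfolding scheme_valid_on_def disj_mono_scheme_def by blast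
  moreover have "sat F V t (Impl (Var p) (Var p'))"
    using imp t by (simp add: sat_Impl_iff del: sat.simps(6))
  ultimately have "sat F V t (Impl (LDisj (Var p) (Var q)) (LDisj (Var p') (Var q)))"
    using V t valid_on_ImplD by blast
  then have "sat F V t (LDisj (Var p) (Var q)) \<Longrightarrow> sat F V t (LDisj (Var p') (Var q))"
    by (rule sat_ImplD[OF t])
  then show ?thesis
    using le V t by (simp add: sat_LDisj_Var_iff del: sat.simps(4))
qed

lemma disj_mono_invalid:
  assumes "infinite (UNIV :: 'p set)" "finite (worlds F)" "\<not> distributive_frame F"
  shows "\<not> scheme_valid_on F (disj_mono_scheme :: 'p form set)"
proof
  assume mono: "scheme_valid_on F (disj_mono_scheme :: 'p form set)"
  obtain t r s b where
    W: "t \<subseteq> worlds F" "r \<subseteq> worlds F" "s \<subseteq> worlds F" "b \<subseteq> worlds F"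
    and wit: "team_le F t (tjoin F r s)" "\<not> team_le F t b"
    "\<And>u. u \<subseteq> worlds F \<Longrightarrow> team_le F u r \<Longrightarrow> team_le F u t \<Longrightarrow> team_le F u b"
    "\<And>u. u \<subseteq> worlds F \<Longrightarrow> team_le F u s \<Longrightarrow> team_le F u t \<Longrightarrow> team_le F u b"
    using non_distributive_witness[OF assms(2,3)] by metis
  \<comment> \<open>Three distinct variables are needed to name \<open>r\<close>, \<open>s\<close>
    and \<open>b\<close>. Here \<open>undefined\<close> is just some variable to differ
    from.\<close>
  obtain p q :: 'p where "p \<noteq> q"
    using ex_new_if_finite[OF assms(1), of "{undefined}"] by blast
  moreover obtain p' where "p' \<notin> {p, q}"
    using ex_new_if_finite[OF assms(1), of "{p, q}"] by blast
  ultimately have ne: "p \<noteq> q" "p' \<noteq> p" "p' \<noteq> q"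
    by simp_all
  define V where "V x = (if x = p then r else if x = q then s else b)" for x
  have V: "V p = r" "V q = s" "V p' = b" "valuation_on F V"
    using W ne by (auto simp: V_def valuation_on_iff)
  have "team_le F t (tjoin F b s)"
    using disj_mono_Var[OF mono V(4) W(1), of p p' q] wit V(1-3) by simp
  \<comment> \<open>Axiom (3) changes the left disjunct only, so the cover is swapped before
    \<open>s\<close> is replaced.\<close>
  then have "team_le F t (tjoin F s b)"
    using W join_commute[of s b] by simp
  \<comment> \<open>In this second use \<open>p'\<close> is both the new left disjunct and the
    unchanged right one.\<close>
  then have "team_le F t (tjoin F b b)"
    using disj_mono_Var[OF mono V(4) W(1), of q p' p'] wit V(1-3) by simp
  then show False using wit(2) W join_idem by simp
qed

end

theorem corollary4p25:
  fixes F :: "'w frame"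
  assumes "infinite (UNIV :: 'p set)"
    and "general_team_frame F"
    and "finite (worlds F)"
    and "classical_frame F"
    and "\<not> distributive_frame F"
  shows "\<not> scheme_valid_on F (disj_elim_scheme :: 'p form set)
    \<and> \<not> scheme_valid_on F (disj_mono_scheme :: 'p form set)
    \<and> \<not> scheme_valid_on F (disj_idem_scheme :: 'p form set)
    \<and> (\<exists>(\<alpha> :: 'p form) V t s.
         standard \<alpha> \<and> valuation_on F V \<and> t \<subseteq> worlds F \<and> s \<subseteq> worlds F \<and>
         sat F V t \<alpha> \<and> sat F V s \<alpha> \<and> \<not> sat F V (tjoin F t s) \<alpha>)"
proof -
  interpret classical_team_frame F
    using assms(2,4) by unfold_locales
  obtain p q :: 'p where "p \<noteq> q"
    using ex_new_if_finite[OF assms(1), of "{undefined}"] by blast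
  then obtain V t s where
    join: "valuation_on F V" "t \<subseteq> worlds F" "s \<subseteq> worlds F"
    "sat F V t (Impl (Var p) (Var q))" "sat F V s (Impl (Var p) (Var q))"
    "\<not> sat F V (tjoin F t s) (Impl (Var p) (Var q))"
    using not_closed_under_joins[OF assms(3,5)] by metis
  have std: "standard (Impl (Var p) (Var q))" by simp
  have idem: "\<not> scheme_valid_on F (disj_idem_scheme :: 'p form set)"
    using disj_idem_imp_join_closed[OF _ std] join by blast
  moreover have "\<not> scheme_valid_on F (disj_elim_scheme :: 'p form set)"
    using idem disj_elim_imp_disj_idem by blast
  moreover have "\<not> scheme_valid_on F (disj_mono_scheme :: 'p form set)"
    using disj_mono_invalid assms(1,3,5) by blast
  ultimately show ?thesis using std join by blast
qed

end
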